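(* Let $\mathcal C$ be a class of ordered graphs of bounded degree (there is $d$ with $\Delta(G)\le d$ for all $(G,\prec)\in\mathcal C$). Then $\mathcal C$ has bounded stretch-width (there is $k$ with $\mathrm{stw}(G,\prec)\le k$ for all $(G,\prec)\in\mathcal C$) if and only if there is an integer $t$ such that no graph in $\{\mathrm{Ov}(G,\prec) : (G,\prec)\in\mathcal C\}$ has a $K_{t,t}$ subgraph.
   Context: An ordered graph $(G,\prec)$ is a finite simple graph with a strict total order $\prec$ on $V(G)$. For an edge $e$, $L(e)$ and $R(e)$ denote its $\prec$-smaller and $\prec$-larger endpoint. Edges $e,f$ cross if $L(e)\prec L(f)\prec R(e)\prec R(f)$ or $L(f)\prec L(e)\prec R(f)\prec R(e)$. The overlap graph $\mathrm{Ov}(G,\prec)$ has vertex set $E(G)$ and an edge between any two crossing edges. Subgraphs need not be induced. A partition sequence of an $n$-vertex graph $G$ is a sequence $\mathcal P_n,\dots,\mathcal P_1$ of partitions of $V(G)$ with $\mathcal P_n$ the singleton partition, $\mathcal P_1=\{V(G)\}$, each obtained from the previous by merging two parts. Distinct parts $X,Y$ are inhomogeneous if there are $u,u'\in X$, $v,v'\in Y$ with $uv\in E(G)$, $u'v'\notin E(G)$; the red graph $\mathcal R(\mathcal P)$ has vertex set $\mathcal P$ and edges between inhomogeneous parts. The span of $X\subseteq V(G)$ is $\langle X\rangle=\{v:\min X\preceq v\preceq\max X\}$; $X,Y$ conflict if their spans intersect. For $X\in\mathcal P$, $Y\in\mathcal P\setminus\{X\}$ interferes with $X$ if $Y$ conflicts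 with the union of the parts in the closed neighborhood of $X$ in $\mathcal R(\mathcal P)$; the stretch of $X$ is the number of parts interfering with it; the stretch of $\mathcal P$ is the maximum over parts. $\mathrm{stw}(G,\prec)$ is the minimum over partition sequences of the maximum stretch of its partitions. *)

theory Defs
  imports Complex_Main "HOL-Library.Disjoint_Sets" "HOL-Library.Ramsey"
begin

record 'a sgraph =
  verts :: "'a set"
  edges :: "'a set set"

record 'a ordered_graph = "'a sgraph" +
  prec :: "'a rel"

definition simple_graph :: "('a, 'b) sgraph_scheme \<Rightarrow> bool" where
  "simple_graph G \<longleftrightarrow> finite (verts G) \<and> edges G \<subseteq> nsets (verts G) 2"

definition is_ordered_graph :: "'a ordered_graph \<Rightarrow> bool" where
  "is_ordered_graph G \<longleftrightarrow> simple_graph G \<and> prec G \<subseteq> verts G \<times> verts G \<and>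
     strict_linear_order_on (verts G) (prec G)"

(* In the type nat, SUP over a nonempty finite set is its maximum, SUP over the empty set is 0,
   and INF over a nonempty set is its minimum. *)

definition degree :: "('a, 'b) sgraph_scheme \<Rightarrow> 'a \<Rightarrow> nat" where
  "degree G v = card {u \<in> verts G. {u, v} \<in> edges G}"

definition max_degree :: "('a, 'b) sgraph_scheme \<Rightarrow> nat" where
  "max_degree G = (SUP v\<in>verts G. degree G v)"

definition has_subgraph :: "('a, 'b) sgraph_scheme \<Rightarrow> ('c, 'd) sgraph_scheme \<Rightarrow> bool" where
  "has_subgraph G H \<longleftrightarrow> (\<exists>f. inj_on f (verts H) \<and> f ` verts H \<subseteq> verts G \<and>
     (\<forall>e\<in>edges H. f ` e \<in> edges G))"

definition complete_bipartite :: "nat \<Rightarrow> nat \<Rightarrow> (nat + nat) sgraph" where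
  "complete_bipartite s t =
     \<lparr>verts = {..<s} <+> {..<t}, edges = {{Inl i, Inr j} | i j. i < s \<and> j < t}\<rparr>"

definition preceq :: "'a ordered_graph \<Rightarrow> 'a \<Rightarrow> 'a \<Rightarrow> bool" where
  "preceq G u v \<longleftrightarrow> u = v \<or> (u, v) \<in> prec G"

(* Only meaningful on nonempty sets of vertices; on an edge these are its endpoints L and R. *)
definition omin :: "'a ordered_graph \<Rightarrow> 'a set \<Rightarrow> 'a" where
  "omin G X = (THE m. m \<in> X \<and> (\<forall>x\<in>X. preceq G m x))"

definition omax :: "'a ordered_graph \<Rightarrow> 'a set \<Rightarrow> 'a" where
  "omax G X = (THE m. m \<in> X \<and> (\<forall>x\<in>X. preceq G x m))"

definition crossing :: "'a ordered_graph \<Rightarrow> 'a set \<Rightarrow> 'a set \<Rightarrow> bool" where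
  "crossing G e f \<longleftrightarrow>
     (omin G e, omin G f) \<in> prec G \<and> (omin G f, omax G e) \<in> prec G \<and> (omax G e, omax G f) \<in> prec G \<or>
     (omin G f, omin G e) \<in> prec G \<and> (omin G e, omax G f) \<in> prec G \<and> (omax G f, omax G e) \<in> prec G"

definition overlap_graph :: "'a ordered_graph \<Rightarrow> 'a set sgraph" where
  "overlap_graph G =
     \<lparr>verts = edges G, edges = {{e, f} | e f. e \<in> edges G \<and> f \<in> edges G \<and> crossing G e f}\<rparr>"

definition merge_step :: "'a set set \<Rightarrow> 'a set set \<Rightarrow> bool" where
  "merge_step P Q \<longleftrightarrow> (\<exists>X\<in>P. \<exists>Y\<in>P. X \<noteq> Y \<and> Q = (P - {X, Y}) \<union> {X \<union> Y})"

(* Only the values of P at 1, ..., card (verts G) matter. For the graph without vertices the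
   sequence is void, which gives stretch-width 0. *)
definition partition_sequence :: "('a, 'b) sgraph_scheme \<Rightarrow> (nat \<Rightarrow> 'a set set) \<Rightarrow> bool" where
  "partition_sequence G P \<longleftrightarrow>
     (\<forall>i\<in>{1..card (verts G)}. partition_on (verts G) (P i)) \<and>
     P (card (verts G)) = (\<lambda>v. {v}) ` verts G \<and>
     P 1 = {verts G} \<and>
     (\<forall>i\<in>{1..<card (verts G)}. merge_step (P (Suc i)) (P i))"

definition inhomogeneous :: "('a, 'b) sgraph_scheme \<Rightarrow> 'a set \<Rightarrow> 'a set \<Rightarrow> bool" where
  "inhomogeneous G X Y \<longleftrightarrow> X \<noteq> Y \<and>
     (\<exists>u\<in>X. \<exists>u'\<in>X. \<exists>v\<in>Y. \<exists>v'\<in>Y. {u, v} \<in> edges G \<and> {u', v'} \<notin> edges G)"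

definition red_graph :: "('a, 'b) sgraph_scheme \<Rightarrow> 'a set set \<Rightarrow> 'a set sgraph" where
  "red_graph G P =
     \<lparr>verts = P, edges = {{X, Y} | X Y. X \<in> P \<and> Y \<in> P \<and> inhomogeneous G X Y}\<rparr>"

definition closed_nbhd :: "('a, 'b) sgraph_scheme \<Rightarrow> 'a \<Rightarrow> 'a set" where
  "closed_nbhd G v = insert v {u \<in> verts G. {u, v} \<in> edges G}"

definition ospan :: "'a ordered_graph \<Rightarrow> 'a set \<Rightarrow> 'a set" where
  "ospan G X = {v \<in> verts G. preceq G (omin G X) v \<and> preceq G v (omax G X)}"

definition conflict :: "'a ordered_graph \<Rightarrow> 'a set \<Rightarrow> 'a set \<Rightarrow> bool" where
  "conflict G X Y \<longleftrightarrow> ospan G X \<inter> ospan G Y \<noteq> {}"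

definition interferes :: "'a ordered_graph \<Rightarrow> 'a set set \<Rightarrow> 'a set \<Rightarrow> 'a set \<Rightarrow> bool" where
  "interferes G P Y X \<longleftrightarrow> Y \<in> P - {X} \<and> conflict G Y (\<Union> (closed_nbhd (red_graph G P) X))"

definition part_stretch :: "'a ordered_graph \<Rightarrow> 'a set set \<Rightarrow> 'a set \<Rightarrow> nat" where
  "part_stretch G P X = card {Y. interferes G P Y X}"

definition stretch :: "'a ordered_graph \<Rightarrow> 'a set set \<Rightarrow> nat" where
  "stretch G P = (SUP X\<in>P. part_stretch G P X)"

definition stw :: "'a ordered_graph \<Rightarrow> nat" where
  "stw G = (INF P\<in>{P. partition_sequence G P}. SUP i\<in>{1..card (verts G)}. stretch G (P i))"

end

(* Bounded stretch-width excludes a biclique: consider the first partition of the sequence in which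
   some part X contains more than d endpoints of edges of a K_{t,t} in the overlap graph. If X
   contains an endpoint of e, then X has an edge, necessarily red, to the part of the other
   endpoint (unless both coincide), so the few parts interfering with X contain an endpoint of
   every edge crossing e. As each part still contains only boundedly many endpoints, t is bounded.

   Conversely, keep an interval partition in which every edge spanning at least s = 8t parts joins
   two singletons, and repeatedly merge two consecutive parts not incident to such a long edge.
   Red edges are then short, whence the stretch is bounded. If no merge is possible, then long edges
   start or end almost everywhere. At the left end of the order they start, at the right end they
   end, so somewhere a window of s/2 parts with t starts is followed by one with t ends. Long edges
   starting in the first window end beyond the second one and vice versa, so they all cross. *)

theory Submission
  imports Defs
begin

section \<open>Vertex ranks, spans and endpoints of edges\<close>

locale ordered_graph_loc =
  fixes G :: "'a ordered_graph"
  assumes ordered: "is_ordered_graph G"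
begin

abbreviation "V \<equiv> verts G"

text \<open>Counting predecessors turns \<open>prec\<close> into the order of natural numbers. It is
  also the numbering of the singleton partition from which the merging starts.\<close>

definition rank :: "'a \<Rightarrow> nat" where
  "rank v = card {u \<in> V. (u, v) \<in> prec G}"

lemma finite_verts: "finite V"
  using ordered by (auto simp: is_ordered_graph_def simple_graph_def)

lemma finite_edges: "finite (edges G)"
  using ordered finite_verts finite_imp_finite_nsets finite_subset
  by (fastforce simp: is_ordered_graph_def simple_graph_def)

lemma prec_irrefl: "(u, u) \<notin> prec G"
  using ordered by (auto simp: is_ordered_graph_def strict_linear_order_on_def irrefl_def)

lemma prec_trans: "(u, v) \<in> prec G \<Longrightarrow> (v, w) \<in> prec G \<Longrightarrow> (u, w) \<in> prec G"
  using ordered unfolding is_ordered_graph_def strict_linear_order_on_def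
  by (meson transD)

lemma prec_total: "u \<in> V \<Longrightarrow> v \<in> V \<Longrightarrow> u \<noteq> v \<Longrightarrow> (u, v) \<in> prec G \<or> (v, u) \<in> prec G"
  using ordered unfolding is_ordered_graph_def strict_linear_order_on_def total_on_def
  by blast

lemma rank_mono: 
  assumes "u \<in> V" "(u, v) \<in> prec G"
  shows "rank u < rank v"
  unfolding rank_def
proof (rule psubset_card_mono)
  show "finite {u \<in> V. (u, v) \<in> prec G}"
    using finite_verts by simp
  have "u \<in> {u \<in> V. (u, v) \<in> prec G} - {w \<in> V. (w, u) \<in> prec G}"
    using assms prec_irrefl by blast
  then show "{w \<in> V. (w, u) \<in> prec G} \<subset> {u \<in> V. (u, v) \<in> prec G}"
    using assms prec_trans by blast
qed

lemma rank_less_iff: "u \<in> V \<Longrightarrow> v \<in> V \<Longrightarrow> (u, v) \<in> prec G \<longleftrightarrow> rank u < rank v"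
  using rank_mono[of u v] rank_mono[of v u] prec_total[of u v] by fastforce

lemma rank_eq_iff: "u \<in> V \<Longrightarrow> v \<in> V \<Longrightarrow> rank u = rank v \<longleftrightarrow> u = v"
  using rank_mono[of u v] rank_mono[of v u] prec_total[of u v] by fastforce

lemma preceq_iff: "u \<in> V \<Longrightarrow> v \<in> V \<Longrightarrow> preceq G u v \<longleftrightarrow> rank u \<le> rank v"
  by (auto simp: preceq_def rank_less_iff rank_eq_iff le_less)

text \<open>No vertex is its own predecessor, so ranks stay below \<open>card V\<close>; being
  injective, \<open>rank\<close> takes all these values. \<open>good\<close> demands such a gapless
  range.\<close>

lemma rank_image: "rank ` V = {..<card V}"
proof (rule card_subset_eq)
  have "rank v < card V" if "v \<in> V" for v
    unfolding rank_def
    by (rule psubset_card_mono[OF finite_verts]) (use that prec_irrefl in blast)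
  then show "rank ` V \<subseteq> {..<card V}"
    by blast
  show "card (rank ` V) = card {..<card V}"
    by (simp add: card_image inj_on_def rank_eq_iff)
qed simp

lemma ex_max_rank:
  assumes "X \<subseteq> V" "X \<noteq> {}"
  shows "\<exists>m\<in>X. \<forall>x\<in>X. rank x \<le> rank m" "\<exists>m\<in>X. \<forall>x\<in>X. rank m \<le> rank x"
proof -
  have fin: "finite (rank ` X)" "rank ` X \<noteq> {}"
    using assms finite_verts finite_subset by auto
  show "\<exists>m\<in>X. \<forall>x\<in>X. rank x \<le> rank m"
    using Max_in[OF fin] Max_ge[OF fin(1)] by fastforce
  show "\<exists>m\<in>X. \<forall>x\<in>X. rank m \<le> rank x"
    using Min_in[OF fin] Min_le[OF fin(1)] by fastforce
qed

lemma omin_eqI: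
  assumes "X \<subseteq> V" "m \<in> X" "\<And>x. x \<in> X \<Longrightarrow> rank m \<le> rank x"
  shows "omin G X = m"
  unfolding omin_def
proof (rule the_equality)
  show "m \<in> X \<and> (\<forall>x\<in>X. preceq G m x)"
    using assms preceq_iff by blast
  show "m' = m" if "m' \<in> X \<and> (\<forall>x\<in>X. preceq G m' x)" for m'
    using that assms preceq_iff rank_eq_iff[of m' m] by (meson order_antisym subsetD)
qed

lemma omax_eqI:
  assumes "X \<subseteq> V" "m \<in> X" "\<And>x. x \<in> X \<Longrightarrow> rank x \<le> rank m"
  shows "omax G X = m"
  unfolding omax_def
proof (rule the_equality)
  show "m \<in> X \<and> (\<forall>x\<in>X. preceq G x m)"
    using assms preceq_iff by blast
  show "m' = m" if "m' \<in> X \<and> (\<forall>x\<in>X. preceq G x m')" for m'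
    using that assms preceq_iff rank_eq_iff[of m' m] by (meson order_antisym subsetD)
qed

text \<open>The extreme elements of \<open>X\<close> serve as witnesses, so later arguments about
  spans avoid the descriptions in \<open>omin\<close> and \<open>omax\<close>.\<close>

lemma ospan_iff:
  assumes "X \<subseteq> V" "X \<noteq> {}"
  shows "v \<in> ospan G X \<longleftrightarrow> v \<in> V \<and> (\<exists>x\<in>X. rank x \<le> rank v) \<and> (\<exists>x\<in>X. rank v \<le> rank x)"
proof -
  obtain m where m: "m \<in> X" "\<forall>x\<in>X. rank x \<le> rank m"
    using ex_max_rank[OF assms] by blast
  obtain l where l: "l \<in> X" "\<forall>x\<in>X. rank l \<le> rank x"
    using ex_max_rank[OF assms] by blast
  have "omin G X = l" "omax G X = m"
    using m l assms(1) by (auto intro: omin_eqI omax_eqI)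
  then show ?thesis
    unfolding ospan_def using m l assms(1)
    by (auto simp: preceq_iff subset_iff)
qed

lemma edgeE:
  assumes "e \<in> edges G"
  obtains u v where "u \<in> V" "v \<in> V" "rank u < rank v" "e = {u, v}" "omin G e = u" "omax G e = v"
proof -
  have "e \<in> nsets V 2"
    using assms ordered by (auto simp: is_ordered_graph_def simple_graph_def)
  then have e: "e \<subseteq> V" "card e = 2"
    by (auto simp: nsets_def)
  then obtain x y where "e = {x, y}" "x \<noteq> y"
    by (auto simp: card_2_iff)
  then obtain u v where uv: "e = {u, v}" "rank u < rank v" "u \<in> V" "v \<in> V"
  proof (cases "rank x < rank y")
    case False
    then have "rank y < rank x"
      using e \<open>e = {x, y}\<close> \<open>x \<noteq> y\<close> rank_eq_iff[of x y] by simp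
    then show ?thesis
      using that[of y x] e \<open>e = {x, y}\<close> by auto
  qed (use that[of x y] e \<open>e = {x, y}\<close> in auto)
  moreover have "omin G e = u"
    by (rule omin_eqI) (use uv in auto)
  moreover have "omax G e = v"
    by (rule omax_eqI) (use uv in auto)
  ultimately show ?thesis
    using that by blast
qed

lemma edge_subset: "e \<in> edges G \<Longrightarrow> e \<subseteq> V \<and> e \<noteq> {}"
  by (erule edgeE) auto

lemma edge_verts: "{u, v} \<in> edges G \<Longrightarrow> u \<in> V \<and> v \<in> V"
  by (erule edgeE) (auto simp: doubleton_eq_iff)

lemma omin_omax_edge:
  assumes "{u, v} \<in> edges G" "rank u < rank v"
  shows "omin G {u, v} = u" "omax G {u, v} = v"
  using edge_verts[OF assms(1)] assms(2) by (auto intro!: omin_eqI omax_eqI)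

section \<open>Crossing edges and bicliques in the overlap graph\<close>

lemma crossing_sym: "crossing G e f \<Longrightarrow> crossing G f e"
  unfolding crossing_def by blast

lemma crossing_irrefl: "\<not> crossing G e e"
  unfolding crossing_def using prec_irrefl by blast

text \<open>Of two crossing edges each has an endpoint strictly inside the other. \<open>min\<close>
  and \<open>max\<close> leave open which of \<open>x\<close> and \<open>y\<close> comes first,
  since later \<open>x\<close> is just an endpoint inside a given part.\<close>

lemma crossing_endpoint_between:
  assumes "crossing G {x, y} f" "{x, y} \<in> edges G" "f \<in> edges G"
  obtains z where "z \<in> f" "z \<in> V" "min (rank x) (rank y) \<le> rank z" "rank z \<le> max (rank x) (rank y)"
proof -
  obtain u v where uv: "u \<in> V" "v \<in> V" "{x, y} = {u, v}" "rank u < rank v"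
      "omin G {x, y} = u" "omax G {x, y} = v"
    using edgeE[OF assms(2)] by metis
  obtain a b where ab: "a \<in> V" "b \<in> V" "f = {a, b}" "rank a < rank b"
      "omin G f = a" "omax G f = b"
    using edgeE[OF assms(3)] by metis
  have minmax: "min (rank x) (rank y) = rank u" "max (rank x) (rank y) = rank v"
    using uv(3,4) by (auto simp: doubleton_eq_iff)
  have "rank u < rank a \<and> rank a < rank v \<or> rank u < rank b \<and> rank b < rank v"
    using assms(1) uv ab by (auto simp: crossing_def rank_less_iff)
  then show ?thesis
    using that[of a] that[of b] ab minmax by auto
qed

text \<open>No edge crosses itself, so \<open>E\<close> and \<open>F\<close> are disjoint, and
  injections of \<open>{..<t}\<close> into them combine to an embedding.\<close>

lemma biclique_subgraphI:
  assumes "E \<subseteq> edges G" "F \<subseteq> edges G" "t \<le> card E" "t \<le> card F"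
    and cross: "\<And>e f. e \<in> E \<Longrightarrow> f \<in> F \<Longrightarrow> crossing G e f"
  shows "has_subgraph (overlap_graph G) (complete_bipartite t t)"
proof -
  have fin: "finite E" "finite F"
    using assms finite_edges finite_subset by blast+
  obtain \<alpha> where \<alpha>: "\<alpha> ` {..<t} \<subseteq> E" "inj_on \<alpha> {..<t}"
    using card_le_inj[of "{..<t}" E] fin assms by auto
  obtain \<beta> where \<beta>: "\<beta> ` {..<t} \<subseteq> F" "inj_on \<beta> {..<t}"
    using card_le_inj[of "{..<t}" F] fin assms by auto
  have \<alpha>E: "\<alpha> i \<in> E" and \<beta>F: "\<beta> i \<in> F" if "i < t" for i
    using that \<alpha>(1) \<beta>(1) by auto
  have ne: "\<alpha> i \<noteq> \<beta> j" if "i < t" "j < t" for i j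
    using cross[OF \<alpha>E[OF that(1)] \<beta>F[OF that(2)]] crossing_irrefl by metis
  let ?g = "case_sum \<alpha> \<beta>"
  have "inj_on ?g ({..<t} <+> {..<t})"
    using \<alpha>(2) \<beta>(2) ne ne[symmetric] by (auto simp: inj_on_def)
  moreover have "?g ` ({..<t} <+> {..<t}) \<subseteq> edges G"
    using \<alpha>(1) \<beta>(1) assms(1,2) by (auto simp: image_subset_iff)
  moreover have "{\<alpha> i, \<beta> j} \<in> edges (overlap_graph G)" if "i < t" "j < t" for i j
  proof -
    have "crossing G (\<alpha> i) (\<beta> j)" "\<alpha> i \<in> edges G" "\<beta> j \<in> edges G"
      using \<alpha>E[OF that(1)] \<beta>F[OF that(2)] assms(1,2) cross by auto
    then show ?thesis
      unfolding overlap_graph_def by auto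
  qed
  ultimately show ?thesis
    unfolding has_subgraph_def
    by (intro exI[of _ ?g]) (auto simp: complete_bipartite_def overlap_graph_def)
qed

text \<open>The biclique with empty sides embeds in every graph. Positivity of \<open>t\<close>
  later makes the threshold \<open>8 * t\<close> for long edges positive.\<close>

lemma no_biclique_pos:
  "\<not> has_subgraph (overlap_graph G) (complete_bipartite t t) \<Longrightarrow> 0 < t"
  using biclique_subgraphI[of "{}" "{}" 0] by (cases t) simp_all

lemma biclique_subgraphE:
  assumes "has_subgraph (overlap_graph G) (complete_bipartite t t)"
  obtains E F where "E \<subseteq> edges G" "F \<subseteq> edges G" "card E = t" "card F = t"
    "\<And>e f. e \<in> E \<Longrightarrow> f \<in> F \<Longrightarrow> crossing G e f"
proof -
  obtain g where g: "inj_on g ({..<t} <+> {..<t})" "g ` ({..<t} <+> {..<t}) \<subseteq> edges G"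
      "\<forall>e\<in>edges (complete_bipartite t t). g ` e \<in> edges (overlap_graph G)"
    using assms by (auto simp: has_subgraph_def complete_bipartite_def overlap_graph_def)
  show ?thesis
  proof (rule that[of "g ` Inl ` {..<t}" "g ` Inr ` {..<t}"])
    show "g ` Inl ` {..<t} \<subseteq> edges G" "g ` Inr ` {..<t} \<subseteq> edges G"
      using g(2) by auto
    have "inj_on g (Inl ` {..<t})" "inj_on g (Inr ` {..<t})"
      by (rule inj_on_subset[OF g(1)], blast)+
    then show "card (g ` Inl ` {..<t}) = t" "card (g ` Inr ` {..<t}) = t"
      by (simp_all add: card_image)
    fix e f assume "e \<in> g ` Inl ` {..<t}" "f \<in> g ` Inr ` {..<t}"
    then obtain i j where ij: "i < t" "j < t" "e = g (Inl i)" "f = g (Inr j)"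
      by auto
    then have "{Inl i, Inr j} \<in> edges (complete_bipartite t t)"
      by (auto simp: complete_bipartite_def)
    then have "g ` {Inl i, Inr j} \<in> edges (overlap_graph G)"
      using g(3) by blast
    then have "{e, f} \<in> edges (overlap_graph G)"
      using ij by simp
    then have "\<exists>e' f'. {e, f} = {e', f'} \<and> crossing G e' f'"
      by (auto simp: overlap_graph_def)
    then show "crossing G e f"
      using crossing_sym by (auto simp: doubleton_eq_iff)
  qed
qed

section \<open>Bounded stretch-width excludes large bicliques\<close>

lemma degree_le_max_degree: "v \<in> V \<Longrightarrow> degree G v \<le> max_degree G"
  unfolding max_degree_def using finite_verts by (intro cSUP_upper) auto

text \<open>Each vertex of \<open>T\<close> lies on at most \<open>d\<close> edges, and these
  together include all of \<open>F\<close>.\<close>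

lemma card_edges_meeting:
  assumes "F \<subseteq> edges G" "T \<subseteq> V" "max_degree G \<le> d" "\<And>f. f \<in> F \<Longrightarrow> f \<inter> T \<noteq> {}"
  shows "card F \<le> d * card T"
proof -
  have fT: "finite T"
    using assms finite_verts finite_subset by blast
  let ?N = "\<lambda>z. {u \<in> V. {u, z} \<in> edges G}"
  have fN: "finite (?N z)" for z
    using finite_verts by simp
  have "F \<subseteq> (\<Union>z\<in>T. (\<lambda>u. {u, z}) ` ?N z)"
  proof
    fix f assume f: "f \<in> F"
    then obtain z where z: "z \<in> f" "z \<in> T"
      using assms(4) by blast
    obtain u v where "u \<in> V" "v \<in> V" "f = {u, v}"
      using f assms(1) by (meson edgeE subsetD)
    then obtain w where "w \<in> V" "f = {w, z}"
      using z by (metis insert_commute insertE singletonD)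
    then show "f \<in> (\<Union>z\<in>T. (\<lambda>u. {u, z}) ` ?N z)"
      using z f assms(1) by blast
  qed
  then have "card F \<le> card (\<Union>z\<in>T. (\<lambda>u. {u, z}) ` ?N z)"
    using fT fN by (intro card_mono) auto
  also have "\<dots> \<le> (\<Sum>z\<in>T. card ((\<lambda>u. {u, z}) ` ?N z))"
    by (rule card_UN_le[OF fT])
  also have "\<dots> \<le> (\<Sum>z\<in>T. d)"
  proof (rule sum_mono)
    fix z assume "z \<in> T"
    have "card ((\<lambda>u. {u, z}) ` ?N z) \<le> degree G z"
      unfolding degree_def by (rule card_image_le[OF fN])
    then show "card ((\<lambda>u. {u, z}) ` ?N z) \<le> d"
      using degree_le_max_degree[of z] \<open>z \<in> T\<close> assms(2,3) by fastforce
  qed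
  also have "\<dots> = d * card T"
    by simp
  finally show ?thesis .
qed

lemma part_stretch_le_stretch:
  assumes "partition_on V P" "X \<in> P"
  shows "part_stretch G P X \<le> stretch G P"
  unfolding stretch_def using assms finite_elements[OF finite_verts]
  by (intro cSUP_upper) auto

text \<open>A part with more than \<^term>\<open>d\<close> vertices is inhomogeneous to every other part it sends an
  edge to. Hence the parts interfering with \<^term>\<open>X\<close> cover the whole interval below the
  edge \<^term>\<open>e\<close>, and every edge crossing \<^term>\<open>e\<close> has an endpoint there.\<close>

lemma biclique_side_bound:
  assumes part: "partition_on V P" and deg: "max_degree G \<le> d" and str: "stretch G P \<le> k"
    and X: "X \<in> P" "d < card X"
    and e: "e \<in> edges G" "e \<inter> X \<noteq> {}"
    and F: "F \<subseteq> edges G" "\<And>f. f \<in> F \<Longrightarrow> crossing G e f"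
    and S: "\<Union>F \<subseteq> S" "\<And>Z. Z \<in> P \<Longrightarrow> card (Z \<inter> S) \<le> m"
  shows "card F \<le> d * (m * Suc k)"
proof -
  obtain x where x: "x \<in> e" "x \<in> X"
    using e by blast
  then obtain y where y: "e = {x, y}"
    using e(1) by (metis edgeE insert_commute insertE singletonD)
  have V: "x \<in> V" "y \<in> V"
    using edge_verts e y by auto
  have sub: "Z \<subseteq> V" if "Z \<in> P" for Z
    using that part by (auto simp: partition_on_def)
  have finX: "finite X"
    using sub X finite_verts finite_subset by blast
  obtain Y where Y: "y \<in> Y" "Y \<in> P"
    using V part by (auto simp: partition_on_def)
  define U where "U = \<Union> (closed_nbhd (red_graph G P) X)"
  have "Y \<in> closed_nbhd (red_graph G P) X"
  proof (cases "Y = X")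
    case False
    \<comment> \<open>Otherwise all of \<open>X\<close>, more than \<open>d\<close> vertices, would
      be neighbours of \<open>y\<close>.\<close>
    have "\<exists>x'\<in>X. {x', y} \<notin> edges G"
    proof (rule ccontr)
      assume "\<not> ?thesis"
      then have "X \<subseteq> {u \<in> V. {u, y} \<in> edges G}"
        using sub X by blast
      then have "card X \<le> degree G y"
        unfolding degree_def using finite_verts by (intro card_mono) auto
      then show False
        using degree_le_max_degree[OF V(2)] deg X(2) by linarith
    qed
    then have "inhomogeneous G X Y"
      unfolding inhomogeneous_def using False x y Y e by blast
    then show ?thesis
      using X Y by (auto simp: closed_nbhd_def red_graph_def)
  qed (simp add: closed_nbhd_def)
  then have U: "x \<in> U" "y \<in> U"
    using x Y by (auto simp: U_def closed_nbhd_def)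
  have "closed_nbhd (red_graph G P) X \<subseteq> P"
    using X by (auto simp: closed_nbhd_def red_graph_def)
  then have UV: "U \<subseteq> V"
    using sub unfolding U_def by blast
  \<comment> \<open>\<open>interferes\<close> leaves out \<open>X\<close> itself, but
    \<open>X\<close> may also contain endpoints of edges of \<open>F\<close>; hence
    \<open>Suc k\<close> parts in total.\<close>
  define Q where "Q = insert X {Y. interferes G P Y X}"
  have QP: "Q \<subseteq> P"
    using X by (auto simp: Q_def interferes_def)
  have finQ: "finite Q"
    using QP part finite_verts finite_elements finite_subset by blast
  have "card {Y. interferes G P Y X} \<le> k"
    using part_stretch_le_stretch[OF part X(1)] str by (simp add: part_stretch_def)
  then have cardQ: "card Q \<le> Suc k"
    unfolding Q_def using finQ[unfolded Q_def] by (simp add: card_insert_if)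
  define T where "T = (\<Union>Z\<in>Q. Z \<inter> S)"
  have "card F \<le> d * card T"
  proof (rule card_edges_meeting[OF F(1) _ deg])
    show "T \<subseteq> V"
      using QP sub by (auto simp: T_def)
    fix f assume f: "f \<in> F"
    obtain z where z: "z \<in> f" "z \<in> V" "min (rank x) (rank y) \<le> rank z" "rank z \<le> max (rank x) (rank y)"
      using crossing_endpoint_between[of x y f] f F e y by blast
    obtain Z where Z: "z \<in> Z" "Z \<in> P"
      using z part by (auto simp: partition_on_def)
    \<comment> \<open>\<open>U\<close> contains both ends of \<open>e\<close>, so its span contains
      every vertex between them.\<close>
    have "z \<in> ospan G U"
      using z U UV by (subst ospan_iff) (auto simp: min_def max_def split: if_splits)
    moreover have "z \<in> ospan G Z"
      using z Z sub by (subst ospan_iff) auto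
    ultimately have "Z \<in> Q"
      using Z unfolding Q_def interferes_def conflict_def U_def by blast
    then show "f \<inter> T \<noteq> {}"
      using z Z S(1) f unfolding T_def by blast
  qed
  also have "card T \<le> (\<Sum>Z\<in>Q. card (Z \<inter> S))"
    unfolding T_def by (rule card_UN_le[OF finQ])
  also have "\<dots> \<le> (\<Sum>Z\<in>Q. m)"
    using S(2) QP by (intro sum_mono) blast
  also have "\<dots> \<le> m * Suc k"
    using mult_le_mono2[OF cardQ, of m] by (simp add: mult.commute)
  finally show ?thesis
    by simp
qed

lemma merge_step_card_le:
  assumes "merge_step P Q" "\<And>Z. Z \<in> P \<Longrightarrow> card (Z \<inter> S) \<le> d" "Z \<in> Q"
  shows "card (Z \<inter> S) \<le> 2 * d"
proof -
  obtain X Y where XY: "X \<in> P" "Y \<in> P" "Q = (P - {X, Y}) \<union> {X \<union> Y}"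
    using assms(1) unfolding merge_step_def by blast
  show ?thesis
  proof (cases "Z = X \<union> Y")
    case True
    have "card (Z \<inter> S) \<le> card (X \<inter> S) + card (Y \<inter> S)"
      unfolding True Int_Un_distrib2 by (rule card_Un_le)
    then show ?thesis
      using assms(2)[OF XY(1)] assms(2)[OF XY(2)] by linarith
  next
    case False
    then have "Z \<in> P"
      using XY(3) assms(3) by blast
    then show ?thesis
      using assms(2)[of Z] by linarith
  qed
qed

text \<open>The factors stand for \<open>d\<close> edges at a vertex, \<open>2 * d\<close> relevant
  endpoints in a part just after a merge, and \<open>Suc k\<close> parts that together meet all
  edges of one side.\<close>

lemma biclique_size_bound:
  assumes seq: "partition_sequence G P"
    and str: "\<And>i. i \<in> {1..card V} \<Longrightarrow> stretch G (P i) \<le> k"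
    and deg: "max_degree G \<le> d" and "0 < d"
    and sub: "has_subgraph (overlap_graph G) (complete_bipartite t t)"
  shows "t \<le> d * (2 * d * Suc k)"
proof (rule ccontr)
  assume contr: "\<not> ?thesis"
  obtain E F where EF: "E \<subseteq> edges G" "F \<subseteq> edges G" "card E = t" "card F = t"
    and cross: "\<And>e f. e \<in> E \<Longrightarrow> f \<in> F \<Longrightarrow> crossing G e f"
    using biclique_subgraphE[OF sub] by blast
  define S where "S = \<Union>E \<union> \<Union>F"
  define big where "big i \<longleftrightarrow> (\<exists>Z\<in>P i. d < card (Z \<inter> S))" for i
  have SV: "S \<subseteq> V"
    using EF(1,2) edge_subset unfolding S_def by blast
  \<comment> \<open>The \<open>t\<close> edges of \<open>E\<close> need many endpoints, so the
    single part \<open>V\<close> of the last partition is big.\<close>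
  have "card E \<le> d * card S"
  proof (rule card_edges_meeting[OF EF(1) SV deg])
    fix f assume "f \<in> E"
    moreover then have "f \<noteq> {}"
      using EF(1) edge_subset by blast
    ultimately show "f \<inter> S \<noteq> {}"
      unfolding S_def by blast
  qed
  then have "d * (2 * d * Suc k) < d * card S"
    using contr EF(3) by linarith
  then have S_large: "2 * d * Suc k < card S"
    by simp
  then have dS: "d < card S"
    by simp
  have SleV: "card S \<le> card V"
    by (rule card_mono[OF finite_verts SV])
  have "V \<inter> S = S"
    using SV by blast
  then have "big 1"
    using seq dS by (auto simp: big_def partition_sequence_def)
  have notbig: "\<not> big (card V)"
  proof -
    \<comment> \<open>Here \<open>0 < d\<close> matters, as a singleton may consist of an element of
      \<open>S\<close>.\<close>
    have "card ({v} \<inter> S) \<le> d" for v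
      using \<open>0 < d\<close> card_mono[of "{v}" "{v} \<inter> S"] by simp
    then show ?thesis
      using seq by (auto simp: big_def partition_sequence_def not_less)
  qed
  have V1: "1 \<le> card V"
    using dS SleV by linarith
  \<comment> \<open>Indices decrease along the sequence, so the maximum picks the earliest partition
    with a big part.\<close>
  define i where "i = Max {i \<in> {1..card V}. big i}"
  have ne: "{i \<in> {1..card V}. big i} \<noteq> {}"
    using \<open>big 1\<close> V1 by auto
  have i: "i \<in> {1..card V}" "big i"
    using Max_in[OF _ ne] by (auto simp: i_def)
  have "i \<noteq> card V"
    using notbig i by blast
  then have i': "i \<in> {1..<card V}"
    using i by auto
  have "\<not> big (Suc i)"
  proof
    assume "big (Suc i)"
    then have "Suc i \<le> i"
      unfolding i_def using i' by (intro Max_ge) (auto simp: i_def)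
    then show False by simp
  qed
  then have before: "card (Z \<inter> S) \<le> d" if "Z \<in> P (Suc i)" for Z
    using that by (auto simp: big_def not_less)
  have "merge_step (P (Suc i)) (P i)"
    using seq i' by (simp add: partition_sequence_def)
  then have small: "card (Z \<inter> S) \<le> 2 * d" if "Z \<in> P i" for Z
    using before that by (rule merge_step_card_le)
  have part: "partition_on V (P i)"
    using seq i by (auto simp: partition_sequence_def)
  obtain X where X: "X \<in> P i" "d < card (X \<inter> S)"
    using i by (auto simp: big_def)
  have "finite X"
    using X(1) part finite_verts by (auto simp: partition_on_def intro: finite_subset)
  then have cX: "d < card X"
    using X(2) card_mono[of X "X \<inter> S"] by simp
  have "X \<inter> S \<noteq> {}"
    using X(2) by auto
  \<comment> \<open>Crossing is symmetric, so \<open>E\<close> and \<open>F\<close> may exchange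
    roles according to whose edge meets \<open>X\<close>.\<close>
  then consider e where "e \<in> E" "e \<inter> X \<noteq> {}" | f where "f \<in> F" "f \<inter> X \<noteq> {}"
    unfolding S_def by blast
  then have "t \<le> d * (2 * d * Suc k)"
  proof cases
    case 1
    then show ?thesis
      using biclique_side_bound[OF part deg str[OF i(1)] X(1) cX _ _ EF(2), of e S "2 * d"]
        EF cross small unfolding S_def by auto
  next
    case 2
    then show ?thesis
      using biclique_side_bound[OF part deg str[OF i(1)] X(1) cX _ _ EF(1), of f S "2 * d"]
        EF cross crossing_sym small unfolding S_def by auto
  qed
  then show False
    using contr by blast
qed

section \<open>Interval partitions and merging of consecutive parts\<close>

definition fibre :: "('a \<Rightarrow> nat) \<Rightarrow> nat \<Rightarrow> 'a set" where
  "fibre f i = {v \<in> V. f v = i}"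

text \<open>Only attained values index parts, which keeps the empty set out of the
  partition.\<close>

definition fibres :: "('a \<Rightarrow> nat) \<Rightarrow> 'a set set" where
  "fibres f = fibre f ` f ` V"

text \<open>The values of \<^term>\<open>f\<close> number the parts of an interval partition from left to right; an
  edge is long if its ends lie at least \<^term>\<open>s\<close> parts apart. Merging only shortens edges, so the
  condition that long edges join singleton parts survives merges that avoid long edges.\<close>

definition long_edge :: "nat \<Rightarrow> ('a \<Rightarrow> nat) \<Rightarrow> 'a \<Rightarrow> 'a \<Rightarrow> bool" where
  "long_edge s f u v \<longleftrightarrow> {u, v} \<in> edges G \<and> f u + s \<le> f v"

definition good :: "nat \<Rightarrow> nat \<Rightarrow> ('a \<Rightarrow> nat) \<Rightarrow> bool" where
  "good s p f \<longleftrightarrow> f ` V = {..<p} \<and> (\<forall>u\<in>V. \<forall>v\<in>V. rank u \<le> rank v \<longrightarrow> f u \<le> f v) \<and>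
     (\<forall>u v. long_edge s f u v \<longrightarrow> fibre f (f u) = {u} \<and> fibre f (f v) = {v})"

text \<open>Lowering the labels beyond \<open>j\<close> keeps them gapless, as \<open>good\<close>
  demands.\<close>

definition merge_at :: "nat \<Rightarrow> ('a \<Rightarrow> nat) \<Rightarrow> 'a \<Rightarrow> nat" where
  "merge_at j f v = (if f v \<le> j then f v else f v - 1)"

lemma good_mono: "good s p f \<Longrightarrow> u \<in> V \<Longrightarrow> v \<in> V \<Longrightarrow> rank u \<le> rank v \<Longrightarrow> f u \<le> f v"
  by (simp add: good_def)

lemma good_prec: "good s p f \<Longrightarrow> u \<in> V \<Longrightarrow> v \<in> V \<Longrightarrow> f u < f v \<Longrightarrow> rank u < rank v"
  using good_mono by (metis leD linorder_not_less)

lemma fibres_partition: "partition_on V (fibres f)"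
  by (auto simp: partition_on_def fibres_def fibre_def disjoint_def)

text \<open>All parts are singletons at the start, so the condition on long edges holds for every
  \<open>s\<close>.\<close>

lemma good_rank: "good s (card V) rank"
  by (auto simp: good_def rank_image fibre_def rank_eq_iff long_edge_def dest: edge_verts)

lemma fibres_rank: "fibres rank = (\<lambda>v. {v}) ` V"
  by (auto simp: fibres_def fibre_def image_image rank_eq_iff intro!: image_cong)

lemma fibre_merge_at:
  "fibre (merge_at j f) i =
     (if i < j then fibre f i else if i = j then fibre f j \<union> fibre f (Suc j) else fibre f (Suc i))"
  by (auto simp: fibre_def merge_at_def split: if_splits)

lemma merge_at_image:
  assumes img: "f ` V = {..<p}" and j: "Suc j < p"
  shows "merge_at j f ` V = {..<p - 1}"
proof -
  have "merge_at j f ` V = (\<lambda>i. if i \<le> j then i else i - 1) ` f ` V"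
    by (auto simp: merge_at_def image_image)
  moreover have "i \<in> (\<lambda>i. if i \<le> j then i else i - 1) ` {..<p}" if "i < p - 1" for i
    using that j by (cases "i \<le> j") (auto intro!: image_eqI[of _ _ "if i \<le> j then i else Suc i"])
  ultimately show ?thesis
    unfolding img using j by auto
qed

lemma good_merge_at:
  assumes good: "good s p f" and "0 < s" and j: "Suc j < p"
    and short: "\<And>u v. long_edge s f u v \<Longrightarrow> f u \<notin> {j, Suc j} \<and> f v \<notin> {j, Suc j}"
  shows "good s (p - 1) (merge_at j f)"
proof -
  have img: "f ` V = {..<p}"
    using good by (simp add: good_def)
  have img': "merge_at j f ` V = {..<p - 1}"
    by (rule merge_at_image[OF img j])
  have mono: "merge_at j f u \<le> merge_at j f v" if "u \<in> V" "v \<in> V" "rank u \<le> rank v" for u v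
    using good_mono[OF good that] by (auto simp: merge_at_def)
  have "fibre (merge_at j f) (merge_at j f u) = {u} \<and> fibre (merge_at j f) (merge_at j f v) = {v}"
    if "long_edge s (merge_at j f) u v" for u v
  proof -
    \<comment> \<open>If \<open>f u < f v\<close>, merging cannot increase the difference of the
      labels. Positivity of \<open>s\<close> matters: for \<open>s = 0\<close> an edge from part
      \<open>Suc j\<close> back to part \<open>j\<close> would become long.\<close>
    have "long_edge s f u v"
      using that \<open>0 < s\<close> by (auto simp: long_edge_def merge_at_def split: if_splits)
    then have *: "f u \<notin> {j, Suc j}" "f v \<notin> {j, Suc j}" "fibre f (f u) = {u}" "fibre f (f v) = {v}"
      using short good unfolding good_def by blast+
    have "fibre (merge_at j f) (merge_at j f w) = fibre f (f w)" if "f w \<notin> {j, Suc j}" for w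
      using that by (auto simp: fibre_merge_at merge_at_def)
    then show ?thesis
      using * by simp
  qed
  then show ?thesis
    using img' mono by (simp add: good_def)
qed

lemma merge_step_merge_at:
  assumes good: "good s p f" and j: "Suc j < p"
  shows "merge_step (fibres f) (fibres (merge_at j f))"
proof -
  have img: "f ` V = {..<p}"
    using good by (simp add: good_def)
  have in_V: "\<exists>v\<in>V. f v = i" if "i < p" for i
    using img that by (metis imageE lessThan_iff)
  let ?X = "fibre f j" and ?Y = "fibre f (Suc j)"
  have XY: "?X \<in> fibres f" "?Y \<in> fibres f"
    unfolding fibres_def img using j by auto
  \<comment> \<open>A nonempty fibre determines its label.\<close>
  have inj: "fibre f a = fibre f b \<longleftrightarrow> a = b" if "a < p" for a b
    using in_V[OF that] by (auto simp: fibre_def)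
  have "fibres (merge_at j f) = (fibres f - {?X, ?Y}) \<union> {?X \<union> ?Y}"
  proof -
    have img': "merge_at j f ` V = {..<p - 1}"
      by (rule merge_at_image[OF img j])
    show ?thesis
    proof (intro set_eqI iffI)
      fix Z assume "Z \<in> fibres (merge_at j f)"
      then obtain i where "i < p - 1" "Z = fibre (merge_at j f) i"
        unfolding fibres_def img' by blast
      then show "Z \<in> (fibres f - {?X, ?Y}) \<union> {?X \<union> ?Y}"
        unfolding fibre_merge_at fibres_def img using inj j
        by (auto split: if_splits)
    next
      fix Z assume "Z \<in> (fibres f - {?X, ?Y}) \<union> {?X \<union> ?Y}"
      then consider "Z = ?X \<union> ?Y" | i where "i < p" "i \<noteq> j" "i \<noteq> Suc j" "Z = fibre f i"
        unfolding fibres_def img by blast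
      then show "Z \<in> fibres (merge_at j f)"
      proof cases
        case 1
        then have "Z = fibre (merge_at j f) j"
          by (simp add: fibre_merge_at)
        then show ?thesis
          unfolding fibres_def img' using j by auto
      next
        case 2
        then have "Z = fibre (merge_at j f) (if i < j then i else i - 1)"
          by (auto simp: fibre_merge_at)
        moreover have "(if i < j then i else i - 1) < p - 1"
          using 2 j by auto
        ultimately show ?thesis
          unfolding fibres_def img' by blast
      qed
    qed
  qed
  moreover have "?X \<noteq> ?Y"
    using inj[of j "Suc j"] j by simp
  ultimately show ?thesis
    unfolding merge_step_def using XY by blast
qed

section \<open>Stretch of good interval partitions\<close>

lemma inhomogeneous_sym:
  assumes "inhomogeneous G X Y"
  shows "inhomogeneous G Y X"
proof -
  obtain u u' v v' where uv: "X \<noteq> Y" "u \<in> X" "u' \<in> X" "v \<in> Y" "v' \<in> Y"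
      "{v, u} \<in> edges G" "{v', u'} \<notin> edges G"
    using assms by (auto simp: inhomogeneous_def insert_commute)
  then show ?thesis
    unfolding inhomogeneous_def by blast
qed

text \<open>The red graph only has short edges, because long edges join singletons.\<close>

lemma good_stretch:
  assumes good: "good s p f"
  shows "stretch G (fibres f) \<le> 2 * s + 1"
proof -
  have "part_stretch G (fibres f) X \<le> 2 * s + 1" if X: "X \<in> fibres f" for X
  proof -
    obtain x where x: "x \<in> V" "X = fibre f (f x)"
      using X by (auto simp: fibres_def)
    define U where "U = \<Union> (closed_nbhd (red_graph G (fibres f)) X)"
    have UV: "U \<subseteq> V"
      using X by (auto simp: U_def closed_nbhd_def red_graph_def fibres_def fibre_def)
    have "x \<in> U"
      using x by (auto simp: U_def closed_nbhd_def fibre_def)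
    have near: "f u \<le> f x + s \<and> f x \<le> f u + s" if u: "u \<in> U" for u
    proof (cases "u \<in> X")
      case False
      then obtain Z where Z: "Z \<in> fibres f" "u \<in> Z" "{Z, X} \<in> edges (red_graph G (fibres f))"
        using u by (auto simp: U_def closed_nbhd_def red_graph_def)
      then have "inhomogeneous G Z X"
        using inhomogeneous_sym by (auto simp: red_graph_def doubleton_eq_iff)
      then obtain a b a' b' where ab: "a \<in> Z" "b \<in> X" "{a, b} \<in> edges G"
          "a' \<in> Z" "b' \<in> X" "{a', b'} \<notin> edges G"
        unfolding inhomogeneous_def by blast
      have Zu: "Z = fibre f (f u)"
        using Z by (auto simp: fibres_def fibre_def)
      then have fab: "f a = f u" "f b = f x" "f a' = f u" "f b' = f x"
        using ab x by (auto simp: fibre_def)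
      \<comment> \<open>Two singletons are always homogeneous to each other.\<close>
      have "\<not> (fibre f (f a) = {a} \<and> fibre f (f b) = {b})"
      proof
        assume "fibre f (f a) = {a} \<and> fibre f (f b) = {b}"
        then have "Z = {a}" "X = {b}"
          using Zu x(2) fab by simp_all
        then show False
          using ab by simp
      qed
      then have "\<not> long_edge s f a b" "\<not> long_edge s f b a"
        using good unfolding good_def by blast+
      moreover have "{b, a} \<in> edges G"
        using ab(3) by (simp add: insert_commute)
      ultimately show ?thesis
        using ab(3) fab(1,2) by (simp add: long_edge_def)
    qed (use x in \<open>auto simp: fibre_def\<close>)
    \<comment> \<open>By monotonicity the span of \<open>U\<close> has only labels within
      \<open>s\<close> of \<open>f x\<close>, while the span of a part \<open>Y\<close> has a single
      label. This leaves at most \<open>2 * s + 1\<close> labels for \<open>Y\<close>.\<close>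
    have "{Y. interferes G (fibres f) Y X} \<subseteq> fibre f ` {f x - s..f x + s}"
    proof
      fix Y assume "Y \<in> {Y. interferes G (fibres f) Y X}"
      then have Y: "Y \<in> fibres f" "ospan G Y \<inter> ospan G U \<noteq> {}"
        by (auto simp: interferes_def conflict_def U_def)
      then obtain y where y: "y \<in> V" "Y = fibre f (f y)"
        by (auto simp: fibres_def)
      obtain v where v: "v \<in> ospan G Y" "v \<in> ospan G U"
        using Y by blast
      have YV: "Y \<subseteq> V" "Y \<noteq> {}"
        using y by (auto simp: fibre_def)
      obtain y1 y2 where y12: "y1 \<in> Y" "y2 \<in> Y" "rank y1 \<le> rank v" "rank v \<le> rank y2" "v \<in> V"
        using v YV by (auto simp: ospan_iff)
      obtain u1 u2 where u12: "u1 \<in> U" "u2 \<in> U" "rank u1 \<le> rank v" "rank v \<le> rank u2"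
        using v UV \<open>x \<in> U\<close> ospan_iff[of U v] by blast
      have "f y1 = f y" "f y2 = f y"
        using y y12 by (auto simp: fibre_def)
      moreover have "f y1 \<le> f v" "f v \<le> f y2"
        using y12 YV good_mono[OF good] by blast+
      ultimately have "f v = f y"
        by simp
      moreover have "f u1 \<le> f v" "f v \<le> f u2"
        using y12 u12 UV good_mono[OF good] by blast+
      ultimately have "f y \<in> {f x - s..f x + s}"
        using near[OF u12(1)] near[OF u12(2)] by auto
      then show "Y \<in> fibre f ` {f x - s..f x + s}"
        using y by blast
    qed
    then have "card {Y. interferes G (fibres f) Y X} \<le> card {f x - s..f x + s}"
      by (intro surj_card_le) auto
    then show ?thesis
      by (simp add: part_stretch_def)
  qed
  \<comment> \<open>Without vertices there are no parts, and the supremum over the empty set is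
    0.\<close>
  then show ?thesis
    unfolding stretch_def by (cases "fibres f = {}") (auto intro: cSUP_least)
qed

section \<open>Finding mergeable parts when a biclique is excluded\<close>

text \<open>The window splits into \<open>n\<close> disjoint pairs \<open>m + 2 * i\<close>,
  \<open>m + 2 * i + 1\<close>, and \<open>g\<close> selects an element of \<open>A\<close> from
  each.\<close>

lemma card_window_ge:
  fixes A :: "nat set"
  assumes A: "\<And>j. Suc j < p \<Longrightarrow> j \<in> A \<or> Suc j \<in> A" and "m + 2 * n \<le> p"
  shows "n \<le> card (A \<inter> {m..<m + 2 * n})"
proof -
  define g where "g i = (if m + 2 * i \<in> A then m + 2 * i else m + 2 * i + 1)" for i
  have "inj_on g {..<n}"
    by (auto simp: inj_on_def g_def split: if_splits)
  moreover have "g ` {..<n} \<subseteq> A \<inter> {m..<m + 2 * n}"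
  proof
    fix x assume "x \<in> g ` {..<n}"
    then obtain i where i: "i < n" "x = g i"
      by blast
    then have "m + 2 * i \<in> A \<or> Suc (m + 2 * i) \<in> A"
      using assms by (intro A) simp
    then show "x \<in> A \<inter> {m..<m + 2 * n}"
      using i by (auto simp: g_def)
  qed
  ultimately show ?thesis
    by (metis card_image card_lessThan card_mono finite_Int finite_atLeastLessThan)
qed

text \<open>The threshold \<open>2 * h\<close> is the joint length of both windows, which forces all
  the crossings. The hypotheses count labels, but distinct labels come from distinct edges, so both
  sides have at least \<open>t\<close> edges.\<close>

lemma adjacent_windows_biclique:
  assumes good: "good (2 * h) p f" and h: "0 < h"
    and L: "t \<le> card ({f u | u v. long_edge (2 * h) f u v} \<inter> {m..<m + h})"
    and R: "t \<le> card ({f v | u v. long_edge (2 * h) f u v} \<inter> {m + h..<m + 2 * h})"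
  shows "has_subgraph (overlap_graph G) (complete_bipartite t t)"
proof -
  let ?l = "long_edge (2 * h) f"
  define E where "E = {{u, v} | u v. ?l u v \<and> f u \<in> {m..<m + h}}"
  define F where "F = {{u, v} | u v. ?l u v \<and> f v \<in> {m + h..<m + 2 * h}}"
  have sub: "E \<subseteq> edges G" "F \<subseteq> edges G"
    by (auto simp: E_def F_def long_edge_def)
  then have fin: "finite E" "finite F"
    using finite_edges finite_subset by blast+
  have ends: "u \<in> V" "v \<in> V" "omin G {u, v} = u" "omax G {u, v} = v" if "?l u v" for u v
  proof -
    have uv: "{u, v} \<in> edges G" "f u < f v"
      using that h by (auto simp: long_edge_def)
    then show V: "u \<in> V" "v \<in> V"
      using edge_verts by blast+
    have "rank u < rank v"
      using good_prec[OF good V uv(2)] .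
    then show "omin G {u, v} = u" "omax G {u, v} = v"
      using omin_omax_edge[OF uv(1)] by blast+
  qed
  have "{f u | u v. ?l u v} \<inter> {m..<m + h} \<subseteq> (\<lambda>e. f (omin G e)) ` E"
  proof
    fix i assume "i \<in> {f u | u v. ?l u v} \<inter> {m..<m + h}"
    then obtain u v where uv: "?l u v" "i = f u" "f u \<in> {m..<m + h}"
      by blast
    then have "{u, v} \<in> E"
      unfolding E_def by blast
    then show "i \<in> (\<lambda>e. f (omin G e)) ` E"
      using ends(3)[OF uv(1)] uv(2) by (intro image_eqI) simp_all
  qed
  then have E: "t \<le> card E"
    using L surj_card_le[OF fin(1)] le_trans by blast
  have "{f v | u v. ?l u v} \<inter> {m + h..<m + 2 * h} \<subseteq> (\<lambda>e. f (omax G e)) ` F"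
  proof
    fix i assume "i \<in> {f v | u v. ?l u v} \<inter> {m + h..<m + 2 * h}"
    then obtain u v where uv: "?l u v" "i = f v" "f v \<in> {m + h..<m + 2 * h}"
      by blast
    then have "{u, v} \<in> F"
      unfolding F_def by blast
    then show "i \<in> (\<lambda>e. f (omax G e)) ` F"
      using ends(4)[OF uv(1)] uv(2) by (intro image_eqI) simp_all
  qed
  then have F: "t \<le> card F"
    using R surj_card_le[OF fin(2)] le_trans by blast
  show ?thesis
  proof (rule biclique_subgraphI[OF sub E F])
    fix e e' assume "e \<in> E" "e' \<in> F"
    then obtain u v u' v' where e: "e = {u, v}" "?l u v" "f u \<in> {m..<m + h}"
      and e': "e' = {u', v'}" "?l u' v'" "f v' \<in> {m + h..<m + 2 * h}"
      unfolding E_def F_def by blast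
    have "f u' < f u" "f u < f v'" "f v' < f v"
      using e(2,3) e'(2,3) by (auto simp: long_edge_def)
    moreover note V = ends(1,2)[OF e(2)] ends(1,2)[OF e'(2)]
    ultimately have "rank u' < rank u" "rank u < rank v'" "rank v' < rank v"
      using good_prec[OF good] by blast+
    then show "crossing G e e'"
      using V unfolding crossing_def e(1) e'(1) ends(3,4)[OF e(2)] ends(3,4)[OF e'(2)]
      by (simp add: rank_less_iff)
  qed
qed

text \<open>A window of length \<open>4 * t\<close> consists of \<open>2 * t\<close> pairs of
  consecutive labels. If no merge is possible, each pair contains an end of a long edge, so the
  window has \<open>t\<close> left ends or \<open>t\<close> right ends. The threshold
  \<open>8 * t\<close> is twice this length.\<close>

lemma mergeable_exists:
  assumes good: "good (8 * t) p f" and p: "2 \<le> p"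
    and no: "\<not> has_subgraph (overlap_graph G) (complete_bipartite t t)"
  shows "\<exists>j. Suc j < p \<and>
    (\<forall>u v. long_edge (8 * t) f u v \<longrightarrow> f u \<notin> {j, Suc j} \<and> f v \<notin> {j, Suc j})"
proof (rule ccontr)
  assume stuck: "\<not> ?thesis"
  define h where "h = 4 * t"
  have h2: "8 * t = 2 * h"
    by (simp add: h_def)
  let ?l = "long_edge (2 * h) f"
  define L where "L = {f u | u v. ?l u v}"
  define R where "R = {f v | u v. ?l u v}"
  have good: "good (2 * h) p f"
    using good h2 by simp
  have img: "f ` V = {..<p}"
    using good by (simp add: good_def)
  have t: "0 < t"
    using no_biclique_pos[OF no] by simp
  have cover: "j \<in> L \<union> R \<or> Suc j \<in> L \<union> R" if j: "Suc j < p" for j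
  proof -
    obtain u v where uv: "?l u v" "f u \<in> {j, Suc j} \<or> f v \<in> {j, Suc j}"
      using stuck j unfolding h2 by blast
    then have "f u \<in> L" "f v \<in> R"
      unfolding L_def R_def by blast+
    then show ?thesis
      using uv(2) by auto
  qed
  have long_less: "f v < p" if "?l u v" for u v
  proof -
    have "v \<in> V"
      using that edge_verts by (auto simp: long_edge_def)
    then show ?thesis
      using img by blast
  qed
  have L_less: "i + 2 * h < p" if "i \<in> L" for i
    using that long_less unfolding L_def long_edge_def by fastforce
  have R_ge: "2 * h \<le> i" if "i \<in> R" for i
    using that by (auto simp: R_def long_edge_def)
  \<comment> \<open>The first two parts cannot be merged, so some long edge exists and
    \<open>p\<close> exceeds its length.\<close>
  obtain u v where "?l u v"
    using cover[of 0] p unfolding L_def R_def by auto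
  then have ph: "2 * h < p"
    using long_less[of u v] by (simp add: long_edge_def)
  let ?W = "\<lambda>j. {j * h..<j * h + h}"
  have many: "2 * t \<le> card (L \<inter> ?W j) + card (R \<inter> ?W j)" if "j * h + h \<le> p" for j
  proof -
    have "2 * t \<le> card ((L \<union> R) \<inter> {j * h..<j * h + 2 * (2 * t)})"
      using that cover by (intro card_window_ge[of p]) (auto simp: h_def)
    also have "\<dots> = card ((L \<inter> ?W j) \<union> (R \<inter> ?W j))"
      by (simp add: h_def Int_Un_distrib2)
    also have "\<dots> \<le> card (L \<inter> ?W j) + card (R \<inter> ?W j)"
      by (rule card_Un_le)
    finally show ?thesis .
  qed
  have hpos: "0 < h"
    using t by (simp add: h_def)
  \<comment> \<open>\<open>J\<close> is the last complete window; fewer than \<open>h\<close> labels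
    follow it.\<close>
  define J where "J = p div h - 1"
  have "p div h \<ge> 1"
    using ph hpos by (simp add: div_greater_zero_iff Suc_leI)
  then have Jh: "J * h + h = p div h * h"
    unfolding J_def by (metis Suc_eq_plus1 add.commute le_add_diff_inverse mult_Suc plus_1_eq_Suc)
  have J: "J * h + h \<le> p" "p < J * h + 2 * h"
    using Jh div_mult_mod_eq[of p h] mod_less_divisor[OF hpos, of p] by linarith+
  \<comment> \<open>A long edge starting at label \<open>J * h\<close> or later would end beyond the
    last label.\<close>
  have "L \<inter> ?W J = {}"
    using L_less J by fastforce
  then have RJ: "t \<le> card (R \<inter> ?W J)"
    using many[OF J(1)] by simp
  \<comment> \<open>In the leftmost window with \<open>t\<close> right ends, minimality ensures that
    the window before has fewer, hence \<open>t\<close> left ends by \<open>many\<close>.\<close>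
  define j where "j = (LEAST j. t \<le> card (R \<inter> ?W j))"
  have Rj: "t \<le> card (R \<inter> ?W j)"
    unfolding j_def using RJ by (rule LeastI)
  have jJ: "j \<le> J"
    unfolding j_def using RJ by (rule Least_le)
  \<comment> \<open>Right ends have labels at least \<open>2 * h\<close>, so the leftmost such
    window has a predecessor.\<close>
  have "R \<inter> ?W 0 = {}"
    using R_ge hpos by fastforce
  then have "j \<noteq> 0"
    using Rj t by (intro notI) simp
  then obtain i where i: "j = Suc i"
    using not0_implies_Suc by blast
  have "\<not> t \<le> card (R \<inter> ?W i)"
    using not_less_Least[of i "\<lambda>j. t \<le> card (R \<inter> ?W j)"] i j_def by simp
  moreover have "i * h + h \<le> p"
    using mult_le_mono1[OF jJ, of h] i J(1) by simp
  ultimately have "t \<le> card (L \<inter> ?W i)"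
    using many[of i] by simp
  moreover have "?W j = {i * h + h..<i * h + 2 * h}"
  proof -
    have "j * h = i * h + h" "j * h + h = i * h + 2 * h"
      using i by simp_all
    then show ?thesis
      by (simp only:)
  qed
  ultimately show False
    using adjacent_windows_biclique[OF good hpos, of t "i * h"] Rj no by (simp add: L_def R_def)
qed

section \<open>Partition sequences and stretch-width\<close>

text \<open>The bound is \<open>2 * s + 1\<close> from \<open>good_stretch\<close> with
  \<open>s = 8 * t\<close>.\<close>

lemma small_stretch_sequence:
  assumes no: "\<not> has_subgraph (overlap_graph G) (complete_bipartite t t)"
  shows "\<exists>P. partition_sequence G P \<and> (\<forall>i\<in>{1..card V}. stretch G (P i) \<le> 16 * t + 1)"
proof (cases "V = {}")
  case True
  \<comment> \<open>Here \<open>P 0\<close> must be the empty family of singletons, while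
    \<open>P 1\<close> must be \<open>{V}\<close>, that is \<open>{{}}\<close>.\<close>
  then show ?thesis
    by (intro exI[of _ "\<lambda>i. if i = 0 then {} else {{}}"]) (auto simp: partition_sequence_def)
next
  case False
  define n where "n = card V"
  have t: "0 < 8 * t"
    using no_biclique_pos[OF no] by simp
  have n: "0 < n"
    using False finite_verts by (simp add: n_def card_gt_0_iff)
  \<comment> \<open>\<open>m\<close> counts merges, so \<open>n - m\<close> parts remain. From
    \<open>m = n\<close> on nothing is demanded, which makes the choice total.\<close>
  have "\<exists>g. \<forall>m. ((m = 0 \<longrightarrow> g m = rank) \<and> (m < n \<longrightarrow> good (8 * t) (n - m) (g m))) \<and>
      (Suc m < n \<longrightarrow> merge_step (fibres (g m)) (fibres (g (Suc m))))"
  proof (rule dependent_nat_choice)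
    show "\<exists>f. (0 = (0::nat) \<longrightarrow> f = rank) \<and> (0 < n \<longrightarrow> good (8 * t) (n - 0) f)"
      using good_rank by (auto simp: n_def)
    fix f and m :: nat
    assume f: "(m = 0 \<longrightarrow> f = rank) \<and> (m < n \<longrightarrow> good (8 * t) (n - m) f)"
    show "\<exists>f'. ((Suc m = 0 \<longrightarrow> f' = rank) \<and> (Suc m < n \<longrightarrow> good (8 * t) (n - Suc m) f')) \<and>
      (Suc m < n \<longrightarrow> merge_step (fibres f) (fibres f'))"
    proof (cases "Suc m < n")
      case True
      then have g: "good (8 * t) (n - m) f" "2 \<le> n - m"
        using f by auto
      then obtain j where j: "Suc j < n - m"
        "\<And>u v. long_edge (8 * t) f u v \<Longrightarrow> f u \<notin> {j, Suc j} \<and> f v \<notin> {j, Suc j}"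
        using mergeable_exists[OF g no] by blast
      show ?thesis
        using good_merge_at[OF g(1) t j] merge_step_merge_at[OF g(1) j(1)]
        by (intro exI[of _ "merge_at j f"]) simp
    qed auto
  qed
  then obtain g where g0: "g 0 = rank"
    and good: "\<And>m. m < n \<Longrightarrow> good (8 * t) (n - m) (g m)"
    and step: "\<And>m. Suc m < n \<Longrightarrow> merge_step (fibres (g m)) (fibres (g (Suc m)))"
    by blast
  \<comment> \<open>Partition sequences are indexed by the number of parts, \<open>g\<close> by the
    number of merges.\<close>
  define P where "P i = fibres (g (n - i))" for i
  have "P 1 = {V}"
  proof -
    have img: "g (n - 1) ` V = {..<1}"
      using good[of "n - 1"] n by (simp add: good_def)
    then have "fibre (g (n - 1)) 0 = V"
      by (auto simp: fibre_def)
    then show ?thesis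
      unfolding P_def fibres_def img by (simp add: lessThan_Suc)
  qed
  moreover have "merge_step (P (Suc i)) (P i)" if "i \<in> {1..<n}" for i
    using step[of "n - Suc i"] that by (simp add: P_def Suc_diff_Suc)
  ultimately have "partition_sequence G P"
    unfolding partition_sequence_def n_def[symmetric]
    using g0 fibres_partition fibres_rank by (simp add: P_def)
  moreover have "stretch G (P i) \<le> 16 * t + 1" if "i \<in> {1..n}" for i
    using good_stretch[OF good[of "n - i"]] that n by (simp add: P_def)
  ultimately show ?thesis
    unfolding n_def by blast
qed

lemma stw_le:
  assumes "partition_sequence G P" "\<And>i. i \<in> {1..card V} \<Longrightarrow> stretch G (P i) \<le> k"
  shows "stw G \<le> k"
proof -
  have "stw G \<le> (SUP i\<in>{1..card V}. stretch G (P i))"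
    unfolding stw_def using assms(1) by (intro cINF_lower) auto
  \<comment> \<open>For a graph without vertices the index range is empty and the supremum is
    0.\<close>
  also have "\<dots> \<le> k"
    using assms(2) by (cases "{1..card V} = {}") (auto simp del: atLeastatMost_empty_iff intro: cSUP_least)
  finally show ?thesis .
qed

text \<open>A nonempty set of natural numbers attains its infimum, so it suffices that some
  partition sequence exists.\<close>

lemma stw_attained:
  obtains P where "partition_sequence G P" "\<And>i. i \<in> {1..card V} \<Longrightarrow> stretch G (P i) \<le> stw G"
proof -
  let ?c = "\<lambda>P. SUP i\<in>{1..card V}. stretch G (P i)"
  \<comment> \<open>Each side of a biclique consists of distinct edges, so this size is impossible,
    and \<open>small_stretch_sequence\<close> yields a sequence.\<close>
  have "\<not> has_subgraph (overlap_graph G) (complete_bipartite (Suc (card (edges G))) (Suc (card (edges G))))"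
    using card_mono[OF finite_edges] by (metis biclique_subgraphE not_less_eq_eq order_refl)
  then have "{P. partition_sequence G P} \<noteq> {}"
    using small_stretch_sequence by blast
  then have "stw G \<in> ?c ` {P. partition_sequence G P}"
    unfolding stw_def by (intro Inf_nat_def1) simp
  then obtain P where P: "partition_sequence G P" "stw G = ?c P"
    by auto
  have "stretch G (P i) \<le> stw G" if "i \<in> {1..card V}" for i
    unfolding P(2) using that by (intro cSUP_upper) auto
  then show ?thesis
    using that P(1) by blast
qed

lemma biclique_size_bound_stw:
  assumes "max_degree G \<le> d" "0 < d" "has_subgraph (overlap_graph G) (complete_bipartite t t)"
  shows "t \<le> d * (2 * d * Suc (stw G))"
  using stw_attained biclique_size_bound assms by metis

lemma stw_bound:
  "\<not> has_subgraph (overlap_graph G) (complete_bipartite t t) \<Longrightarrow> stw G \<le> 16 * t + 1"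
  using small_stretch_sequence stw_le by blast

end

section \<open>Uniform bounds over a class of bounded degree\<close>

theorem theorem23:
  fixes C :: "'a ordered_graph set"
  assumes "\<forall>G\<in>C. is_ordered_graph G"
    and "\<exists>d. \<forall>G\<in>C. max_degree G \<le> d"
  shows "(\<exists>k. \<forall>G\<in>C. stw G \<le> k) \<longleftrightarrow>
    (\<exists>t. \<forall>H\<in>overlap_graph ` C. \<not> has_subgraph H (complete_bipartite t t))"
proof
  have loc: "ordered_graph_loc G" if "G \<in> C" for G
    using that assms(1) by (simp add: ordered_graph_loc_def)
  {
    assume "\<exists>k. \<forall>G\<in>C. stw G \<le> k"
    then obtain k where k: "\<And>G. G \<in> C \<Longrightarrow> stw G \<le> k"
      by blast
    obtain d where d: "\<And>G. G \<in> C \<Longrightarrow> max_degree G \<le> d"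
      using assms(2) by blast
    \<comment> \<open>\<open>Suc d\<close> serves as a positive degree bound, and the outer
      \<open>Suc\<close> exceeds the largest possible biclique.\<close>
    define t where "t = Suc (Suc d * (2 * Suc d * Suc k))"
    have "\<not> has_subgraph (overlap_graph G) (complete_bipartite t t)" if G: "G \<in> C" for G
    proof
      assume "has_subgraph (overlap_graph G) (complete_bipartite t t)"
      then have "t \<le> Suc d * (2 * Suc d * Suc (stw G))"
        using ordered_graph_loc.biclique_size_bound_stw[OF loc[OF G], of "Suc d" t] d[OF G] by simp
      also have "\<dots> \<le> Suc d * (2 * Suc d * Suc k)"
        using k[OF G] by (intro mult_le_mono2) simp
      finally show False
        by (simp add: t_def)
    qed
    then show "\<exists>t. \<forall>H\<in>overlap_graph ` C. \<not> has_subgraph H (complete_bipartite t t)"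
      by blast
  }
  {
    assume "\<exists>t. \<forall>H\<in>overlap_graph ` C. \<not> has_subgraph H (complete_bipartite t t)"
    then obtain t where t: "\<And>G. G \<in> C \<Longrightarrow> \<not> has_subgraph (overlap_graph G) (complete_bipartite t t)"
      by blast
    have "stw G \<le> 16 * t + 1" if "G \<in> C" for G
      by (rule ordered_graph_loc.stw_bound[OF loc[OF that] t[OF that]])
    then show "\<exists>k. \<forall>G\<in>C. stw G \<le> k"
      by blast
  }
qed

end
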